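(* Let $q\ge 6$ be a prime power. A ruled quintic surface $\mathcal V$ of $\mathrm{PG}(6,q)$ contains exactly $q^2$ twisted cubics, and each of them is a directrix of $\mathcal V$, i.e. each lies in a $3$-space disjoint from the plane $\alpha$ of the conic directrix and contains exactly one point of each generator of $\mathcal V$.
   Context: Construction: in $\mathrm{PG}(6,q)$ let $\alpha$ be a plane and $\Pi_3$ a $3$-space with $\alpha\cap\Pi_3=\emptyset$. Let $\mathcal C$ be a non-degenerate conic in $\alpha$ and $\mathcal N_3$ a twisted cubic in $\Pi_3$, parametrised as $\mathcal C=\{(1,\theta,\theta^2)\}$ and $\mathcal N_3=\{(1,\epsilon,\epsilon^2,\epsilon^3)\}$ ($\theta,\epsilon\in\mathbb F_q\cup\{\infty\}$), and let $\phi\in\mathrm{PGL}(2,q)$ act on parameters, giving a bijection $\mathcal C\to\mathcal N_3$. The ruled quintic surface $\mathcal V$ is the set of points on the $q+1$ lines (generators) joining each point of $\mathcal C$ to its image under $\phi$; $\mathcal C$ is its conic directrix. A twisted cubic is a normal rational curve spanning a $3$-space. *)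

theory Defs
  imports "HOL-Analysis.Analysis"
begin

text \<open>Projective spaces over a field are modelled by linear subspaces: a projective \<open>k\<close>-space is a
  linear subspace of dimension \<open>k + 1\<close>, and a point is a projective \<open>0\<close>-space.\<close>

definition proj_space :: "nat \<Rightarrow> ('a::field ^ 'n) set \<Rightarrow> bool" where
  "proj_space k U \<longleftrightarrow> vec.subspace U \<and> vec.dim U = k + 1"

definition proj_points :: "('a::field ^ 'n) set \<Rightarrow> ('a ^ 'n) set set" where
  "proj_points U = {P. proj_space 0 P \<and> P \<subseteq> U}"

definition coord_frame :: "nat \<Rightarrow> ('a::field ^ 'n) set \<Rightarrow> (nat \<Rightarrow> 'a ^ 'n) \<Rightarrow> bool" where
  "coord_frame k U e \<longleftrightarrow>
     inj_on e {..k} \<and> vec.independent (e ` {..k}) \<and> vec.span (e ` {..k}) = U"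

text \<open>Parameters live in \<open>F\<^sub>q \<union> {\<infinity>}\<close>, modelled by \<open>'a option\<close> with \<open>None\<close> for \<open>\<infinity>\<close>.
  The point with parameter \<open>\<theta>\<close> has coordinates \<open>(1, \<theta>, \<dots>, \<theta>\<^sup>k)\<close> with respect to the frame \<open>e\<close>,
  and the point with parameter \<open>\<infinity>\<close> has coordinates \<open>(0, \<dots>, 0, 1)\<close>.\<close>

fun nrc_vector :: "nat \<Rightarrow> (nat \<Rightarrow> 'a::field ^ 'n) \<Rightarrow> 'a option \<Rightarrow> 'a ^ 'n" where
  "nrc_vector k e (Some \<theta>) = (\<Sum>i\<le>k. \<theta> ^ i *s e i)"
| "nrc_vector k e None = e k"

definition nrc_point :: "nat \<Rightarrow> (nat \<Rightarrow> 'a::field ^ 'n) \<Rightarrow> 'a option \<Rightarrow> ('a ^ 'n) set" where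
  "nrc_point k e \<theta> = vec.span {nrc_vector k e \<theta>}"

definition normal_rational_curve ::
    "nat \<Rightarrow> ('a::field ^ 'n) set \<Rightarrow> ('a ^ 'n) set set \<Rightarrow> bool" where
  "normal_rational_curve k U N \<longleftrightarrow>
     proj_space k U \<and> (\<exists>e. coord_frame k U e \<and> N = range (nrc_point k e))"

definition twisted_cubic :: "('a::field ^ 'n) set set \<Rightarrow> bool" where
  "twisted_cubic N \<longleftrightarrow> (\<exists>U. normal_rational_curve 3 U N)"

fun mobius :: "'a::field \<Rightarrow> 'a \<Rightarrow> 'a \<Rightarrow> 'a \<Rightarrow> 'a option \<Rightarrow> 'a option" where
  "mobius a b c d (Some \<theta>) =
     (if c * \<theta> + d = 0 then None else Some ((a * \<theta> + b) / (c * \<theta> + d)))"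
| "mobius a b c d None = (if c = 0 then None else Some (a / c))"

definition PGL2 :: "('a::field option \<Rightarrow> 'a option) set" where
  "PGL2 = {mobius a b c d | a b c d. a * d - b * c \<noteq> 0}"

text \<open>The frames \<open>e\<close> of the plane \<open>\<alpha>\<close> and \<open>f\<close> of the 3-space fix the parametrisations of the conic
  and of the twisted cubic.\<close>

definition generators ::
    "(nat \<Rightarrow> 'a::field ^ 'n) \<Rightarrow> (nat \<Rightarrow> 'a ^ 'n) \<Rightarrow> ('a option \<Rightarrow> 'a option) \<Rightarrow> ('a ^ 'n) set set" where
  "generators e f \<phi> =
     range (\<lambda>\<theta>. vec.span (nrc_point 2 e \<theta> \<union> nrc_point 3 f (\<phi> \<theta>)))"

definition ruled_quintic_surface ::
    "('a::field ^ 7) set \<Rightarrow> ('a ^ 7) set set \<Rightarrow> ('a ^ 7) set set \<Rightarrow> bool" where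
  "ruled_quintic_surface \<alpha> G V \<longleftrightarrow>
     proj_space 2 \<alpha> \<and>
     (\<exists>S e f \<phi>. proj_space 3 S \<and> proj_points \<alpha> \<inter> proj_points S = {} \<and>
        coord_frame 2 \<alpha> e \<and> coord_frame 3 S f \<and> \<phi> \<in> PGL2 \<and>
        G = generators e f \<phi> \<and> V = (\<Union>l\<in>G. proj_points l))"

end

theory Submission
  imports Defs "HOL-Computational_Algebra.Polynomial"
begin

text \<open>
  After a change of frame we may take \<open>\<phi> = id\<close>. More generally, join the points \<open>low t\<close> and
  \<open>high t\<close> of two normal rational curves of degrees \<open>k < m\<close> in disjoint subspaces \<open>A\<close> and \<open>S\<close>.
  For every binary form \<open>p\<close> of degree \<open>m - k\<close>, the points \<open>p(t) low t + high t\<close> form a normal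
  rational curve of degree \<open>m\<close> on the scroll, and this gives \<open>q\<^sup>m\<^sup>-\<^sup>k\<^sup>+\<^sup>1\<close> curves.

  Conversely, let such a curve span \<open>U\<close>, and let \<open>d\<close> be the vector space dimension of \<open>U \<inter> A\<close>.
  Projecting \<open>U\<close> from \<open>A\<close> into \<open>S\<close> gives a subspace of dimension \<open>m + 1 - d\<close>, so if \<open>d > 0\<close> then
  the points of the curve outside \<open>A\<close> lie on at most \<open>m + 1 - d\<close> generators. Any \<open>m + 1\<close> points
  of the curve are independent, so it has at most two points on each generator and at most \<open>d\<close>
  points in \<open>A\<close>, hence at most \<open>2 m\<close> points if \<open>d \<ge> 2\<close>. If \<open>d = 1\<close>, then at most \<open>m\<close> subspaces
  \<open>U \<inter> \<langle>A, high t\<rangle>\<close> of dimension at most 2 cover the curve, and it again has at most \<open>2 m\<close>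
  points. If \<open>q \<ge> 2 m\<close>, its \<open>q + 1\<close> points are too many, so \<open>d = 0\<close>. Then the curve has one
  point \<open>l(t) low t + high t\<close> on each generator, and comparing coordinates shows that \<open>l\<close> is a form
  of degree \<open>m - k\<close>.
\<close>

section \<open>Linear algebra\<close>

lemma (in module) independent_family_iff:
  assumes I: "finite I"
  shows "inj_on v I \<and> independent (v ` I) \<longleftrightarrow>
    (\<forall>g. (\<Sum>i\<in>I. g i *s v i) = 0 \<longrightarrow> (\<forall>i\<in>I. g i = 0))" (is "_ \<longleftrightarrow> ?scalars_zero")
proof (intro iffI allI impI ballI)
  fix g i
  assume v: "inj_on v I \<and> independent (v ` I)" and g: "(\<Sum>i\<in>I. g i *s v i) = 0" and i: "i \<in> I"
  have "(\<Sum>w\<in>v ` I. g (inv_into I v w) *s w) = (\<Sum>i\<in>I. g i *s v i)"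
    using v by (subst sum.reindex) (auto intro!: sum.cong)
  then have "g (inv_into I v (v i)) = 0"
    using independentD[of "v ` I" "v ` I" "\<lambda>w. g (inv_into I v w)" "v i"] v I g i by auto
  then show "g i = 0"
    using v i by simp
next
  assume scalars_zero: ?scalars_zero
  have inj: "inj_on v I"
  proof (rule inj_onI, rule ccontr)
    fix i j
    assume ij: "i \<in> I" "j \<in> I" "v i = v j" "i \<noteq> j"
    let ?g = "(\<lambda>_. 0)(i := 1, j := -1) :: 'c \<Rightarrow> 'a"
    have "(\<Sum>l\<in>I. ?g l *s v l) = (\<Sum>l\<in>{i, j}. ?g l *s v l)"
      using I ij by (intro sum.mono_neutral_right) auto
    also have "\<dots> = 0"
      using ij by simp
    finally show False
      using scalars_zero ij by (metis fun_upd_apply zero_neq_one)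
  qed
  moreover have "independent (v ` I)"
    using scalars_zero I by (auto simp: dependent_finite sum.reindex[OF inj])
  ultimately show "inj_on v I \<and> independent (v ` I)" ..
qed

lemma (in module) add_eq_add_iff_if_Int_zero:
  assumes "subspace A" "subspace S" "A \<inter> S = {0}" "a \<in> A" "a' \<in> A" "s \<in> S" "s' \<in> S"
  shows "a + s = a' + s' \<longleftrightarrow> a = a' \<and> s = s'"
proof
  assume "a + s = a' + s'"
  then have "a - a' = s' - s"
    by (simp add: algebra_simps)
  moreover have "a - a' \<in> A" "s' - s \<in> S"
    using assms subspace_diff by blast+
  ultimately have "a - a' \<in> A \<inter> S"
    by simp
  with \<open>a - a' = s' - s\<close> show "a = a' \<and> s = s'"
    unfolding assms(3) by simp
qed simp

context finite_dimensional_vector_space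
begin

lemma dim_Int_superspace_le:
  assumes "subspace U" "subspace A" "subspace H" "A \<subseteq> H"
  shows "dim (U \<inter> H) + dim A \<le> dim (U \<inter> A) + dim H"
proof -
  have "dim {x + y | x y. x \<in> U \<and> y \<in> A} \<le> dim {x + y | x y. x \<in> U \<and> y \<in> H}"
    using assms(4) by (intro dim_subset) blast
  then show ?thesis
    using dim_sums_Int[OF assms(1,2)] dim_sums_Int[OF assms(1,3)] by linarith
qed

lemma dim_projection_le:
  assumes "subspace U" "subspace A" "subspace S" "A \<inter> S = {0}"
  shows "dim ({x + y | x y. x \<in> U \<and> y \<in> A} \<inter> S) + dim (U \<inter> A) \<le> dim U"
proof -
  let ?UA = "{x + y | x y. x \<in> U \<and> y \<in> A}"
  have UA: "subspace ?UA"
    using assms(1,2) by (rule subspace_sums)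
  have "A \<subseteq> ?UA"
    using subspace_0[OF assms(1)] by force
  then have "{x + y | x y. x \<in> A \<and> y \<in> ?UA \<inter> S} \<subseteq> ?UA"
    using subspace_add[OF UA] by blast
  then have "dim {x + y | x y. x \<in> A \<and> y \<in> ?UA \<inter> S} \<le> dim ?UA"
    by (rule dim_subset)
  moreover have "A \<inter> (?UA \<inter> S) = {0}"
    using assms(4) subspace_0[OF UA] by blast
  then have "dim {x + y | x y. x \<in> A \<and> y \<in> ?UA \<inter> S} = dim A + dim (?UA \<inter> S)"
    using dim_sums_Int[OF assms(2) subspace_inter[OF UA assms(3)]] by simp
  ultimately show ?thesis
    using dim_sums_Int[OF assms(1,2)] by linarith
qed

end

lemma proj_points_disjoint_iff:
  fixes A S :: "('a::field ^ 'n) set"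
  assumes "vec.subspace A" "vec.subspace S"
  shows "proj_points A \<inter> proj_points S = {} \<longleftrightarrow> A \<inter> S = {0}"
proof
  assume disjoint: "proj_points A \<inter> proj_points S = {}"
  have "v = 0" if "v \<in> A" "v \<in> S" for v
  proof (rule ccontr)
    assume "v \<noteq> 0"
    then have "vec.span {v} \<in> proj_points A \<inter> proj_points S"
      using that assms unfolding proj_points_def proj_space_def by (simp add: vec.span_minimal)
    with disjoint show False
      by blast
  qed
  then show "A \<inter> S = {0}"
    using assms vec.subspace_0 by blast
next
  assume "A \<inter> S = {0}"
  then have "P \<subseteq> {0}" if "P \<in> proj_points A \<inter> proj_points S" for P
    using that unfolding proj_points_def by blast
  moreover have "\<not> P \<subseteq> {0}" if "P \<in> proj_points A" for P
    using that vec.dim_eq_0[of P] unfolding proj_points_def proj_space_def by auto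
  ultimately show "proj_points A \<inter> proj_points S = {}"
    by (metis IntD1 equals0I)
qed

lemma span_singleton_scale:
  fixes v :: "'a::field ^ 'n"
  assumes "x \<noteq> 0"
  shows "vec.span {x *s v} = vec.span {v}"
  using vec.span_image_scale[of "{v}" "\<lambda>_. x"] assms by simp

section \<open>Coordinate frames\<close>

lemma coord_frame_iff:
  "coord_frame k U e \<longleftrightarrow>
    (\<forall>g. (\<Sum>i\<le>k. g i *s e i) = 0 \<longrightarrow> (\<forall>i\<le>k. g i = 0)) \<and> vec.span (e ` {..k}) = U"
  unfolding coord_frame_def using vec.independent_family_iff[of "{..k}" e] by auto

lemma coord_frame_subspace: "coord_frame k U e \<Longrightarrow> vec.subspace U"
  unfolding coord_frame_def by (metis vec.subspace_span)

lemma coord_frame_mem: "coord_frame k U e \<Longrightarrow> i \<le> k \<Longrightarrow> e i \<in> U"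
  unfolding coord_frame_def by (metis atMost_iff image_eqI vec.span_base)

lemma coord_frame_sum_mem: "coord_frame k U e \<Longrightarrow> (\<Sum>i\<le>k. g i *s e i) \<in> U"
  by (intro vec.subspace_sum vec.subspace_scale) (simp_all add: coord_frame_subspace coord_frame_mem)

lemma coord_frame_dim: "coord_frame k U e \<Longrightarrow> vec.dim U = k + 1"
  unfolding coord_frame_def using vec.dim_span_eq_card_independent[of "e ` {..k}"]
  by (auto simp: card_image)

lemma coord_frame_coords_eq:
  assumes "coord_frame k U e" "(\<Sum>i\<le>k. g i *s e i) = (\<Sum>i\<le>k. h i *s e i)" "i \<le> k"
  shows "g i = h i"
proof -
  have "(\<Sum>i\<le>k. (g i - h i) *s e i) = 0"
    using assms(2) by (simp add: vec.scale_left_diff_distrib sum_subtractf)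
  moreover have "\<forall>g. (\<Sum>i\<le>k. g i *s e i) = 0 \<longrightarrow> (\<forall>i\<le>k. g i = 0)"
    using assms(1) unfolding coord_frame_iff by (rule conjunct1)
  from this[THEN spec, of "\<lambda>i. g i - h i"] calculation have "g i - h i = 0"
    using assms(3) by simp
  then show ?thesis
    by simp
qed

lemma coord_frame_coords:
  assumes "coord_frame k U e" "u \<in> U"
  obtains g where "u = (\<Sum>i\<le>k. g i *s e i)"
proof -
  have "u \<in> range (\<lambda>g. \<Sum>v\<in>e ` {..k}. g v *s v)"
    using assms vec.span_finite[of "e ` {..k}"] unfolding coord_frame_def by auto
  then obtain h where "u = (\<Sum>v\<in>e ` {..k}. h v *s v)"
    by auto
  also have "\<dots> = (\<Sum>i\<le>k. h (e i) *s e i)"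
    using assms unfolding coord_frame_def by (simp add: sum.reindex)
  finally show ?thesis
    using that[of "\<lambda>i. h (e i)"] by blast
qed

lemma coord_frame_if_dim:
  fixes e :: "nat \<Rightarrow> 'a::field ^ 'n"
  assumes U: "vec.subspace U" "vec.dim U = k + 1" and e: "e ` {..k} \<subseteq> U" "U \<subseteq> vec.span (e ` {..k})"
  shows "coord_frame k U e"
proof -
  have span: "vec.span (e ` {..k}) = U"
    using U e vec.span_minimal by blast
  have "card (e ` {..k}) \<ge> k + 1"
    using vec.dim_le_card[OF e(2)] U by simp
  then have card: "card (e ` {..k}) = k + 1"
    using card_image_le[of "{..k}" e] by simp
  then have "inj_on e {..k}"
    by (intro eq_card_imp_inj_on) auto
  moreover have "vec.independent (e ` {..k})"
    using vec.card_le_dim_spanning[OF e] U card by simp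
  ultimately show ?thesis
    unfolding coord_frame_def using span by blast
qed

section \<open>Binary forms\<close>

text \<open>A binary form \<open>\<Sum>\<^sub>i p\<^sub>i X\<^sup>i Y\<^sup>n\<^sup>-\<^sup>i\<close> of degree \<open>n\<close> is given by a polynomial \<open>p\<close> of degree at
  most \<open>n\<close>; it is evaluated at \<open>(\<theta>, 1)\<close> for the parameter \<open>\<theta>\<close> and at \<open>(1, 0)\<close> for \<open>\<infinity>\<close>.\<close>

definition eval_form :: "nat \<Rightarrow> 'a::comm_semiring_1 poly \<Rightarrow> 'a option \<Rightarrow> 'a" where
  "eval_form n p t = (case t of None \<Rightarrow> coeff p n | Some \<theta> \<Rightarrow> poly p \<theta>)"

lemma eval_form_simps [simp]:
  "eval_form n p None = coeff p n"
  "eval_form n p (Some \<theta>) = poly p \<theta>"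
  unfolding eval_form_def by simp_all

lemma eval_form_mult:
  assumes "degree p \<le> m" "degree q \<le> n"
  shows "eval_form (m + n) (p * q) t = eval_form m p t * eval_form n q t"
proof (cases t)
  case None
  show ?thesis
  proof (cases "degree p = m \<and> degree q = n")
    case True
    then show ?thesis
      using coeff_mult_degree_sum[of p q] None by simp
  next
    case False
    then have "degree (p * q) < m + n" "degree p < m \<or> degree q < n"
      using degree_mult_le[of p q] assms by linarith+
    then show ?thesis
      using None by (auto simp: coeff_eq_0)
  qed
qed simp

lemma linear_form_power:
  assumes "degree p \<le> 1"
  shows "degree (p ^ n) \<le> n" "eval_form n (p ^ n) t = eval_form 1 p t ^ n"
proof -
  show degree: "degree (p ^ n) \<le> n" for n
    using degree_power_le[of p n] assms by (metis mult_le_mono1 nat_mult_1 order_trans)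
  show "eval_form n (p ^ n) t = eval_form 1 p t ^ n"
  proof (induction n)
    case (Suc n)
    then show ?case
      using eval_form_mult[OF assms degree, of n t] by simp
  qed (cases t; simp)
qed

lemma linear_form_prod:
  assumes "finite R" "\<And>r. r \<in> R \<Longrightarrow> degree (p r) \<le> 1"
  shows "degree (\<Prod>r\<in>R. p r) \<le> card R \<and>
    eval_form (card R) (\<Prod>r\<in>R. p r) t = (\<Prod>r\<in>R. eval_form 1 (p r) t)"
  using assms
proof (induction rule: finite_induct)
  case empty
  then show ?case
    by (cases t) simp_all
next
  case (insert r R)
  then have p: "degree (p r) \<le> 1" "degree (\<Prod>r\<in>R. p r) \<le> card R"
    by auto
  show ?case
    using eval_form_mult[OF p, of t] order_trans[OF degree_mult_le add_mono[OF p]] insert by simp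
qed

lemma eval_form_eq_sum:
  assumes "degree p \<le> n"
  shows "eval_form n p t = (\<Sum>i\<le>n. coeff p i * eval_form n (monom 1 i) t)"
proof (cases t)
  case (Some \<theta>)
  have "poly p \<theta> = (\<Sum>i\<le>n. coeff p i * \<theta> ^ i)"
    unfolding poly_altdef using assms by (intro sum.mono_neutral_left) (auto simp: coeff_eq_0)
  then show ?thesis
    using Some by (simp add: poly_monom)
qed (simp add: if_distrib[of "\<lambda>x. _ * x"] cong: if_cong)

lemma separating_form_exists:
  fixes T :: "'a::field option set"
  assumes "finite T" "card T \<le> n" "t \<notin> T"
  obtains p where "degree p \<le> n" "eval_form n p t \<noteq> 0" "\<And>s. s \<in> T \<Longrightarrow> eval_form n p s = 0"
proof -
  define root_form where "root_form s = (case s of None \<Rightarrow> 1 | Some \<eta> \<Rightarrow> [:- \<eta>, 1:])" for s :: "'a option"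
  have degree_root: "degree (root_form s) \<le> 1" for s
    unfolding root_form_def by (cases s) simp_all
  have root: "eval_form 1 (root_form s) r = 0 \<longleftrightarrow> r = s" for r s
    unfolding root_form_def by (cases r; cases s) (auto simp: coeff_eq_0)
  obtain r where "r \<noteq> t"
    by (metis option.distinct(1))
  define p where "p = (\<Prod>s\<in>T. root_form s) * root_form r ^ (n - card T)"
  have prod: "degree (\<Prod>s\<in>T. root_form s) \<le> card T"
    "eval_form (card T) (\<Prod>s\<in>T. root_form s) u = (\<Prod>s\<in>T. eval_form 1 (root_form s) u)" for u
    using linear_form_prod[OF assms(1) degree_root] by auto
  note power = linear_form_power[OF degree_root]
  have "degree p \<le> n"
    using degree_mult_le[of "\<Prod>s\<in>T. root_form s" "root_form r ^ (n - card T)"] prod(1)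
      power(1)[of r "n - card T"] assms(2) unfolding p_def by linarith
  moreover have "eval_form n p u =
      (\<Prod>s\<in>T. eval_form 1 (root_form s) u) * eval_form 1 (root_form r) u ^ (n - card T)" for u
    using eval_form_mult[OF prod(1) power(1)[of r "n - card T"], of u] prod(2) power(2) assms(2)
    unfolding p_def by simp
  ultimately show ?thesis
    using that[of p] assms(1,3) root \<open>r \<noteq> t\<close> by (auto simp: prod_zero_iff)
qed

lemma card_polys_degree_le:
  "card {p :: 'a::{comm_monoid_add,finite} poly. degree p \<le> n} = CARD('a) ^ (n + 1)"
proof (induction n)
  case 0
  have "{p :: 'a poly. degree p \<le> 0} = range (\<lambda>a. [:a:])"
    by (auto elim: degree_eq_zeroE)
  then show ?case
    by (simp add: card_image inj_on_def)
next
  case (Suc n)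
  have "{p :: 'a poly. degree p \<le> Suc n} = (\<lambda>(a, p). pCons a p) ` (UNIV \<times> {p. degree p \<le> n})"
  proof (rule antisym)
    show "{p :: 'a poly. degree p \<le> Suc n} \<subseteq> (\<lambda>(a, p). pCons a p) ` (UNIV \<times> {p. degree p \<le> n})"
    proof
      fix p :: "'a poly"
      assume "p \<in> {p. degree p \<le> Suc n}"
      then show "p \<in> (\<lambda>(a, p). pCons a p) ` (UNIV \<times> {p. degree p \<le> n})"
        by (cases p) (force simp: degree_pCons_eq_if split: if_splits)
    qed
  qed (auto intro: order_trans[OF degree_pCons_le])
  moreover have "inj_on (\<lambda>(a, p). pCons a p) (UNIV \<times> {p :: 'a poly. degree p \<le> n})"
    by (auto simp: inj_on_def)
  ultimately show ?case
    using Suc by (simp add: card_image card_cartesian_product)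
qed

lemma poly_eq_X_mult_if_eval_eq:
  fixes p q :: "'a::{field,finite} poly"
  assumes degree: "degree p \<le> m" "degree q \<le> m" and "coeff q m = 0" and "m < CARD('a)"
    and eval: "\<And>x. poly p x = x * poly q x"
  shows "p = monom 1 1 * q"
proof (rule poly_eqI_degree[of UNIV])
  show "poly p x = poly (monom 1 1 * q) x" for x
    using eval by (simp add: poly_monom)
  have "coeff q i = 0" if "i \<ge> m" for i
    using assms(2,3) that by (cases "i = m") (auto simp: coeff_eq_0)
  then have "degree (monom 1 1 * q) \<le> m"
    by (intro degree_le) (auto simp: coeff_monom_mult)
  then show "degree (monom 1 1 * q) < CARD('a)" "degree p < CARD('a)"
    using degree(1) assms(4) by simp_all
qed

text \<open>The forms \<open>P\<^sub>j = l X\<^sup>j Y\<^sup>k\<^sup>-\<^sup>j\<close> satisfy \<open>Y P\<^sub>j\<^sub>+\<^sub>1 = X P\<^sub>j\<close>, so \<open>P\<^sub>k\<close> is \<open>X\<^sup>k\<close> times a form of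
  degree \<open>m - k\<close>.\<close>

lemma form_quotient_exists:
  fixes P :: "nat \<Rightarrow> 'a::{field,finite} poly"
  assumes "k \<le> m" "m < CARD('a)" and degree: "\<And>j. j \<le> k \<Longrightarrow> degree (P j) \<le> m"
    and eval: "\<And>j t. j \<le> k \<Longrightarrow> eval_form m (P j) t = l t * eval_form k (monom 1 j) t"
  obtains p where "degree p \<le> m - k" "l = eval_form (m - k) p"
proof
  have P_Suc: "P (Suc j) = monom 1 1 * P j" if "Suc j \<le> k" for j
  proof (rule poly_eq_X_mult_if_eval_eq[OF _ _ _ assms(2)])
    show "degree (P (Suc j)) \<le> m" "degree (P j) \<le> m"
      using degree that by simp_all
    show "coeff (P j) m = 0"
      using eval[of j None] that by simp
    show "poly (P (Suc j)) \<theta> = \<theta> * poly (P j) \<theta>" for \<theta>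
      using eval[of j "Some \<theta>"] eval[of "Suc j" "Some \<theta>"] that by (simp add: poly_monom)
  qed
  have P_eq: "P j = monom 1 j * P 0" if "j \<le> k" for j
    using that
  proof (induction j)
    case (Suc j)
    then show ?case
      using P_Suc[of j] by (simp add: mult_monom flip: mult.assoc)
  qed simp
  have P_k: "coeff (P k) (i + k) = coeff (P 0) i" for i
    by (subst P_eq[OF order_refl]) (simp add: coeff_monom_mult)
  show "degree (P 0) \<le> m - k"
  proof (intro degree_le allI impI)
    fix i
    assume "m - k < i"
    then have "degree (P k) < i + k"
      using degree[of k] by linarith
    then show "coeff (P 0) i = 0"
      unfolding P_k[symmetric] by (rule coeff_eq_0)
  qed
  have "l t = eval_form (m - k) (P 0) t" for t
  proof (cases t)
    case None
    then show ?thesis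
      using eval[of k None] P_k[of "m - k"] assms(1) by simp
  next
    case (Some \<theta>)
    then show ?thesis
      using eval[of 0 "Some \<theta>"] by (simp add: poly_monom)
  qed
  then show "l = eval_form (m - k) (P 0)" ..
qed

section \<open>Normal rational curves\<close>

lemma nrc_vector_eq_sum: "nrc_vector k e t = (\<Sum>i\<le>k. eval_form k (monom 1 i) t *s e i)"
  by (cases t) (simp_all add: poly_monom if_distrib[of "\<lambda>x. x *s _"] cong: if_cong)

lemma nrc_vector_mem: "coord_frame k U e \<Longrightarrow> nrc_vector k e t \<in> U"
  unfolding nrc_vector_eq_sum by (rule coord_frame_sum_mem)

lemma nrc_vector_add: "nrc_vector k (\<lambda>i. e i + f i) t = nrc_vector k e t + nrc_vector k f t"
  unfolding nrc_vector_eq_sum by (simp add: vec.scale_right_distrib sum.distrib)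

lemma nrc_vector_coeff_sum:
  assumes "\<And>j. j \<in> J \<Longrightarrow> degree (p j) \<le> k"
  shows "nrc_vector k (\<lambda>i. \<Sum>j\<in>J. coeff (p j) i *s e j) t = (\<Sum>j\<in>J. eval_form k (p j) t *s e j)"
proof -
  have "nrc_vector k (\<lambda>i. \<Sum>j\<in>J. coeff (p j) i *s e j) t =
      (\<Sum>j\<in>J. (\<Sum>i\<le>k. coeff (p j) i * eval_form k (monom 1 i) t) *s e j)"
    unfolding nrc_vector_eq_sum vec.scale_sum_left vec.scale_sum_right
    by (subst sum.swap) (simp add: vec.scale_scale mult.commute)
  then show ?thesis
    using assms by (simp flip: eval_form_eq_sum)
qed

lemma nrc_vectors_independent:
  assumes frame: "coord_frame k U e" and T: "finite T" "card T \<le> k + 1"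
  shows "inj_on (nrc_vector k e) T" "vec.independent (nrc_vector k e ` T)"
proof -
  have "g t = 0" if relation: "(\<Sum>t\<in>T. g t *s nrc_vector k e t) = 0" and "t \<in> T" for g t
  proof -
    have "finite (T - {t})" "card (T - {t}) \<le> k" "t \<notin> T - {t}"
      using T \<open>t \<in> T\<close> by simp_all
    then obtain p where degree: "degree p \<le> k" and "eval_form k p t \<noteq> 0"
      and zeros: "\<And>s. s \<in> T - {t} \<Longrightarrow> eval_form k p s = 0"
      using separating_form_exists by metis
    have "(\<Sum>i\<le>k. (\<Sum>t\<in>T. g t * eval_form k (monom 1 i) t) *s e i) =
        (\<Sum>t\<in>T. g t *s nrc_vector k e t)"
      unfolding nrc_vector_eq_sum vec.scale_sum_left vec.scale_sum_right
      by (subst sum.swap) (simp add: vec.scale_scale)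
    also have "\<dots> = (\<Sum>i\<le>k. 0 *s e i)"
      using relation by simp
    finally have coords: "(\<Sum>t\<in>T. g t * eval_form k (monom 1 i) t) = 0" if "i \<le> k" for i
      using that by (rule coord_frame_coords_eq[OF frame])
    have "g t * eval_form k p t = (\<Sum>t\<in>T. g t * eval_form k p t)"
      using T(1) \<open>t \<in> T\<close> zeros by (simp add: sum.remove)
    also have "\<dots> = (\<Sum>i\<le>k. coeff p i * (\<Sum>t\<in>T. g t * eval_form k (monom 1 i) t))"
      unfolding eval_form_eq_sum[OF degree] sum_distrib_left
      by (subst sum.swap) (simp only: mult.left_commute)
    also have "\<dots> = 0"
      using coords by simp
    finally show ?thesis
      using \<open>eval_form k p t \<noteq> 0\<close> by simp
  qed
  then have "inj_on (nrc_vector k e) T \<and> vec.independent (nrc_vector k e ` T)"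
    unfolding vec.independent_family_iff[OF T(1)] by blast
  then show "inj_on (nrc_vector k e) T" "vec.independent (nrc_vector k e ` T)"
    by simp_all
qed

lemma nrc_vector_nonzero: "coord_frame k U e \<Longrightarrow> nrc_vector k e t \<noteq> 0"
  using nrc_vectors_independent(2)[of k U e "{t}"] by auto

lemma nrc_point_in_proj_points_iff:
  assumes "coord_frame k U e" "vec.subspace W"
  shows "nrc_point k e t \<in> proj_points W \<longleftrightarrow> nrc_vector k e t \<in> W"
proof -
  have "vec.span {v} \<subseteq> W \<longleftrightarrow> v \<in> W" for v
    using vec.span_minimal[of "{v}" W] assms(2) vec.span_base[of v "{v}"] by auto
  then show ?thesis
    using nrc_vector_nonzero[OF assms(1), of t]
    unfolding nrc_point_def proj_points_def proj_space_def by simp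
qed

definition nrc_params :: "nat \<Rightarrow> (nat \<Rightarrow> 'a::field ^ 'n) \<Rightarrow> ('a ^ 'n) set \<Rightarrow> 'a option set" where
  "nrc_params k e W = {t. nrc_vector k e t \<in> W}"

lemma card_nrc_params_le_dim:
  fixes e :: "nat \<Rightarrow> 'a::{field,finite} ^ 'n"
  assumes "coord_frame k U e" "vec.dim W \<le> k"
  shows "card (nrc_params k e W) \<le> vec.dim W"
proof (rule ccontr)
  assume "\<not> ?thesis"
  then obtain T where T: "T \<subseteq> nrc_params k e W" "card T = vec.dim W + 1"
    by (metis Suc_eq_plus1 not_less_eq_eq obtain_subset_with_card_n)
  have "finite T"
    by simp
  note independent = nrc_vectors_independent[OF assms(1) this]
  have "card (nrc_vector k e ` T) \<le> vec.dim W"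
    using T assms independent by (intro vec.independent_card_le_dim) (auto simp: nrc_params_def)
  then show False
    using T assms independent by (simp add: card_image)
qed

lemma card_UN_nrc_params_le:
  fixes e :: "nat \<Rightarrow> 'a::{field,finite} ^ 'n"
  assumes "coord_frame k U e" "finite I" "r \<le> k" "\<And>i. vec.dim (W i) \<le> r"
  shows "card (\<Union>i\<in>I. nrc_params k e (W i)) \<le> card I * r"
proof -
  have "card (nrc_params k e (W i)) \<le> r" for i
    using card_nrc_params_le_dim[OF assms(1), of "W i"] assms(3) assms(4)[of i] by simp
  then have "(\<Sum>i\<in>I. card (nrc_params k e (W i))) \<le> card I * r"
    using sum_bounded_above[of I "\<lambda>i. card (nrc_params k e (W i))" r] by simp
  then show ?thesis
    using card_UN_le[OF assms(2), of "\<lambda>i. nrc_params k e (W i)"] by simp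
qed

lemma nrc_params_eq_if_dim_le_1:
  fixes e :: "nat \<Rightarrow> 'a::{field,finite} ^ 'n"
  assumes "coord_frame k U e" "k \<ge> 1" "vec.dim W \<le> 1" "nrc_vector k e s \<in> W" "nrc_vector k e t \<in> W"
  shows "s = t"
proof -
  have "card (nrc_params k e W) \<le> 1"
    using card_nrc_params_le_dim[OF assms(1), of W] assms(2,3) by linarith
  then show ?thesis
    using assms(4,5) by (simp add: card_le_Suc0_iff_eq nrc_params_def)
qed

lemma nrc_subspace_subset:
  fixes e :: "nat \<Rightarrow> 'a::{field,finite} ^ 'n"
  assumes "coord_frame k U e" "k \<le> CARD('a)" "vec.subspace W" "\<And>t. nrc_vector k e t \<in> W"
  shows "U \<subseteq> W"
proof -
  obtain T :: "'a option set" where T: "card T = k + 1"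
    using assms(2) obtain_subset_with_card_n[of "k + 1" "UNIV :: 'a option set"] by auto
  have "finite T"
    by simp
  note independent = nrc_vectors_independent[OF assms(1) this]
  have "U \<subseteq> vec.span (nrc_vector k e ` T)"
    using T independent coord_frame_dim[OF assms(1)] nrc_vector_mem[OF assms(1)]
    by (intro vec.card_ge_dim_independent) (auto simp: card_image)
  also have "\<dots> \<subseteq> W"
    using assms by (intro vec.span_minimal) auto
  finally show ?thesis .
qed

section \<open>Reparametrisation by the projective linear group\<close>

definition ratio_param :: "'a::field \<Rightarrow> 'a \<Rightarrow> 'a option" where
  "ratio_param x y = (if y = 0 then None else Some (x / y))"

lemma mobius_eq_ratio_param:
  "mobius a b c d t = ratio_param (eval_form 1 [:b, a:] t) (eval_form 1 [:d, c:] t)"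
  by (cases t) (simp_all add: ratio_param_def add.commute mult.commute)

lemma linear_forms_not_both_zero:
  fixes a b c d :: "'a::field"
  assumes "a * d - b * c \<noteq> 0"
  shows "eval_form 1 [:b, a:] t \<noteq> 0 \<or> eval_form 1 [:d, c:] t \<noteq> 0"
proof (cases t)
  case None
  then show ?thesis
    using assms by auto
next
  case (Some \<theta>)
  have "a * (d + \<theta> * c) - c * (b + \<theta> * a) = a * d - b * c"
    by (simp add: algebra_simps)
  then show ?thesis
    using assms Some by auto
qed

lemma inj_mobius:
  fixes a b c d :: "'a::field"
  assumes det: "a * d - b * c \<noteq> 0"
  shows "inj (mobius a b c d)"
proof (rule injI)
  fix s t
  let ?num = "eval_form 1 [:b, a:]" and ?den = "eval_form 1 [:d, c:]"
  let ?x = "eval_form 1 [:0, 1:]" and ?y = "eval_form 1 [:1:]"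
  assume "mobius a b c d s = mobius a b c d t"
  then have "?num s * ?den t = ?num t * ?den s"
    unfolding mobius_eq_ratio_param ratio_param_def by (auto simp: frac_eq_eq split: if_splits)
  moreover have "?num s * ?den t - ?num t * ?den s = (a * d - b * c) * (?x s * ?y t - ?x t * ?y s)"
    by (cases s; cases t) (simp_all add: algebra_simps)
  ultimately have "?x s * ?y t = ?x t * ?y s"
    using det by simp
  then show "s = t"
    by (cases s; cases t) simp_all
qed

lemma span_homogeneous_nrc_vector:
  fixes f :: "nat \<Rightarrow> 'a::field ^ 'n"
  assumes "x \<noteq> 0 \<or> y \<noteq> 0"
  shows "vec.span {\<Sum>j\<le>k. (x ^ j * y ^ (k - j)) *s f j} = nrc_point k f (ratio_param x y)"
proof (cases "y = 0")
  case True
  have "(\<Sum>j\<le>k. (x ^ j * y ^ (k - j)) *s f j) = (\<Sum>j\<in>{k}. (x ^ j * y ^ (k - j)) *s f j)"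
    using True by (intro sum.mono_neutral_right) auto
  then show ?thesis
    using assms True by (simp add: nrc_point_def ratio_param_def span_singleton_scale)
next
  case False
  have "(\<Sum>j\<le>k. (x ^ j * y ^ (k - j)) *s f j) = y ^ k *s (\<Sum>j\<le>k. (x / y) ^ j *s f j)"
    unfolding vec.scale_sum_right
  proof (rule sum.cong[OF refl])
    fix j
    assume "j \<in> {..k}"
    then have "y ^ k = y ^ j * y ^ (k - j)"
      by (simp flip: power_add)
    then show "(x ^ j * y ^ (k - j)) *s f j = y ^ k *s ((x / y) ^ j *s f j)"
      using False by (simp add: vec.scale_scale power_divide)
  qed
  then show ?thesis
    using False by (simp add: nrc_point_def ratio_param_def span_singleton_scale)
qed

lemma coord_frame_if_nrc_points_eq:
  fixes e e' :: "nat \<Rightarrow> 'a::{field,finite} ^ 'n"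
  assumes frame: "coord_frame k U e" and "k \<le> CARD('a)" and "\<And>i. i \<le> k \<Longrightarrow> e' i \<in> U"
    and points: "range (nrc_point k e) \<subseteq> range (nrc_point k e')"
  shows "coord_frame k U e'"
proof (rule coord_frame_if_dim)
  show "U \<subseteq> vec.span (e' ` {..k})"
  proof (rule nrc_subspace_subset[OF frame assms(2) vec.subspace_span])
    fix s
    obtain t where "nrc_point k e s = nrc_point k e' t"
      using points by blast
    then have "nrc_vector k e s \<in> vec.span {nrc_vector k e' t}"
      unfolding nrc_point_def by (metis singletonI vec.span_base)
    moreover have "nrc_vector k e' t \<in> vec.span (e' ` {..k})"
      unfolding nrc_vector_eq_sum by (intro vec.span_sum vec.span_scale vec.span_base) auto
    ultimately show "nrc_vector k e s \<in> vec.span (e' ` {..k})"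
      using vec.span_minimal[of "{nrc_vector k e' t}" "vec.span (e' ` {..k})"] by auto
  qed
qed (use assms coord_frame_subspace coord_frame_dim in auto)

text \<open>A Moebius change of parameter acts on the coordinates \<open>(1, \<theta>, \<dots>, \<theta>\<^sup>k)\<close>, up to the factor
  \<open>(c \<theta> + d)\<^sup>k\<close>, by the linear map with \<open>j\<close>-th component \<open>(a \<theta> + b)\<^sup>j (c \<theta> + d)\<^sup>k\<^sup>-\<^sup>j\<close>.\<close>

lemma nrc_reparametrisation:
  fixes f :: "nat \<Rightarrow> 'a::{field,finite} ^ 'n"
  assumes frame: "coord_frame k S f" and "k \<le> CARD('a)" and "\<phi> \<in> PGL2"
  obtains f' where "coord_frame k S f'" "\<And>t. nrc_point k f' t = nrc_point k f (\<phi> t)"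
proof -
  obtain a b c d where \<phi>: "\<phi> = mobius a b c d" and det: "a * d - b * c \<noteq> 0"
    using assms(3) unfolding PGL2_def by blast
  let ?num = "[:b, a:]" and ?den = "[:d, c:]"
  have linear: "degree ?num \<le> 1" "degree ?den \<le> 1"
    by simp_all
  define p where "p j = ?num ^ j * ?den ^ (k - j)" for j
  define f' where "f' i = (\<Sum>j\<le>k. coeff (p j) i *s f j)" for i
  note powers = linear_form_power[OF linear(1)] linear_form_power[OF linear(2)]
  have "degree (p j) \<le> k" if "j \<le> k" for j
    using order_trans[OF degree_mult_le add_mono[OF powers(1)[of j] powers(3)[of "k - j"]]] that
    unfolding p_def by simp
  moreover have "eval_form k (p j) t = eval_form 1 ?num t ^ j * eval_form 1 ?den t ^ (k - j)"
    if "j \<le> k" for j t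
    using eval_form_mult[OF powers(1)[of j] powers(3)[of "k - j"], of t] powers(2,4) that
    unfolding p_def by simp
  ultimately have "nrc_vector k f' t =
      (\<Sum>j\<le>k. (eval_form 1 ?num t ^ j * eval_form 1 ?den t ^ (k - j)) *s f j)" for t
    using nrc_vector_coeff_sum[of "{..k}" p k f t] unfolding f'_def by simp
  then have points: "nrc_point k f' t = nrc_point k f (\<phi> t)" for t
    unfolding nrc_point_def[of k f'] \<phi> mobius_eq_ratio_param
    using span_homogeneous_nrc_vector[OF linear_forms_not_both_zero[OF det]] by simp
  have "surj \<phi>"
    unfolding \<phi> using inj_mobius[OF det] by (simp add: finite_UNIV_inj_surj)
  moreover have "range (nrc_point k f') = nrc_point k f ` range \<phi>"
    by (simp add: points image_image)
  ultimately have range_subset: "range (nrc_point k f) \<subseteq> range (nrc_point k f')"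
    by simp
  have "f' i \<in> S" for i
    unfolding f'_def using frame by (rule coord_frame_sum_mem)
  then have "coord_frame k S f'"
    using range_subset by (rule coord_frame_if_nrc_points_eq[OF frame assms(2)])
  with points that show ?thesis
    by blast
qed

section \<open>Rational normal scrolls\<close>

locale rational_normal_scroll =
  fixes k m :: nat and A S :: "('a::{field,finite} ^ 'n) set" and e f :: "nat \<Rightarrow> 'a ^ 'n"
  assumes frame_A: "coord_frame k A e" and frame_S: "coord_frame m S f"
    and A_Int_S: "A \<inter> S = {0}" and degree_less: "k < m"
begin

abbreviation "low \<equiv> nrc_vector k e"
abbreviation "high \<equiv> nrc_vector m f"

definition generator :: "'a option \<Rightarrow> ('a ^ 'n) set" where
  "generator t = vec.span {low t, high t}"

definition scroll :: "('a ^ 'n) set set" where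
  "scroll = (\<Union>t. proj_points (generator t))"

lemmas subspace_A = coord_frame_subspace[OF frame_A] and dim_A = coord_frame_dim[OF frame_A]
lemmas subspace_S = coord_frame_subspace[OF frame_S]
lemmas low_mem = nrc_vector_mem[OF frame_A] and high_mem = nrc_vector_mem[OF frame_S]
lemmas scale_low_mem = vec.subspace_scale[OF subspace_A low_mem]
lemmas scale_high_mem = vec.subspace_scale[OF subspace_S high_mem]
lemmas decomposition_unique = vec.add_eq_add_iff_if_Int_zero[OF subspace_A subspace_S A_Int_S]

lemma span_points_eq_generator: "vec.span (nrc_point k e t \<union> nrc_point m f t) = generator t"
  unfolding generator_def nrc_point_def
proof (rule antisym)
  show "vec.span (vec.span {low t} \<union> vec.span {high t}) \<subseteq> vec.span {low t, high t}"
    by (intro vec.span_minimal vec.subspace_span Un_least) (simp_all add: vec.span_base)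
  show "vec.span {low t, high t} \<subseteq> vec.span (vec.span {low t} \<union> vec.span {high t})"
    by (intro vec.span_mono) (simp add: vec.span_base)
qed

lemma mem_generator_iff: "v \<in> generator t \<longleftrightarrow> (\<exists>x y. v = x *s low t + y *s high t)"
proof -
  have "v \<in> generator t \<longleftrightarrow> (\<exists>x y. v - x *s low t = y *s high t)"
    unfolding generator_def vec.span_insert vec.span_singleton by auto
  then show ?thesis
    by (simp add: diff_eq_eq add.commute)
qed

lemma subspace_generator: "vec.subspace (generator t)"
  unfolding generator_def by simp

lemma dim_generator_le: "vec.dim (generator t) \<le> 2"
  using vec.dim_le_card[of "generator t" "{low t, high t}"] unfolding generator_def
  by (auto simp: card_insert_if split: if_splits)

subsection \<open>Directrix curves\<close>

text \<open>The \<open>i\<close>-th vector is the coefficient of \<open>\<theta>\<^sup>i\<close> in \<open>high \<theta> + p(\<theta>) low \<theta>\<close>.\<close>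

definition directrix_frame :: "'a poly \<Rightarrow> nat \<Rightarrow> 'a ^ 'n" where
  "directrix_frame p i = f i + (\<Sum>j\<le>k. coeff (p * monom 1 j) i *s e j)"

definition directrix_space :: "'a poly \<Rightarrow> ('a ^ 'n) set" where
  "directrix_space p = vec.span (directrix_frame p ` {..m})"

definition directrix :: "'a poly \<Rightarrow> ('a ^ 'n) set set" where
  "directrix p = range (nrc_point m (directrix_frame p))"

lemma nrc_vector_directrix_frame:
  assumes "degree p \<le> m - k"
  shows "nrc_vector m (directrix_frame p) t = eval_form (m - k) p t *s low t + high t"
proof -
  have monom: "degree (monom (1 :: 'a) j) \<le> k" if "j \<le> k" for j
    using that by (simp add: degree_monom_eq)
  have "degree (p * monom 1 j) \<le> m" if "j \<le> k" for j
    using order_trans[OF degree_mult_le add_mono[OF assms monom[OF that]]] degree_less by simp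
  then have "nrc_vector m (directrix_frame p) t =
      high t + (\<Sum>j\<le>k. eval_form m (p * monom 1 j) t *s e j)"
    using nrc_vector_coeff_sum[of "{..k}" "\<lambda>j. p * monom 1 j" m e t] nrc_vector_add[of m f]
    unfolding directrix_frame_def[abs_def] by simp
  also have "(\<Sum>j\<le>k. eval_form m (p * monom 1 j) t *s e j) = eval_form (m - k) p t *s low t"
    using eval_form_mult[OF assms monom, of _ t] degree_less
    by (simp add: nrc_vector_eq_sum vec.scale_sum_right vec.scale_scale)
  finally show ?thesis
    by (simp add: add.commute)
qed

lemma directrix_combination_in_A:
  assumes "(\<Sum>i\<le>m. g i *s directrix_frame p i) \<in> A" "i \<le> m"
  shows "g i = 0"
proof -
  define a where "a = (\<Sum>i\<le>m. g i *s (\<Sum>j\<le>k. coeff (p * monom 1 j) i *s e j))"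
  have "a \<in> A"
    unfolding a_def using coord_frame_mem[OF frame_A]
    by (intro vec.subspace_sum vec.subspace_scale subspace_A) simp
  have "(\<Sum>i\<le>m. g i *s directrix_frame p i) + 0 = a + (\<Sum>i\<le>m. g i *s f i)"
    by (simp add: a_def directrix_frame_def vec.scale_right_distrib sum.distrib add.commute)
  then have "(\<Sum>i\<le>m. g i *s f i) = 0"
    using decomposition_unique[OF assms(1) \<open>a \<in> A\<close> vec.subspace_0[OF subspace_S]
        coord_frame_sum_mem[OF frame_S, of g]] by simp
  also have "\<dots> = (\<Sum>i\<le>m. 0 *s f i)"
    by simp
  finally show ?thesis
    using assms(2) by (rule coord_frame_coords_eq[OF frame_S])
qed

lemma coord_frame_directrix: "coord_frame m (directrix_space p) (directrix_frame p)"
  unfolding coord_frame_iff directrix_space_def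
  using directrix_combination_in_A[of _ p] vec.subspace_0[OF subspace_A] by simp

lemmas subspace_directrix_space = coord_frame_subspace[OF coord_frame_directrix]

lemma directrix_space_Int_A: "directrix_space p \<inter> A = {0}"
proof -
  have "v = 0" if "v \<in> directrix_space p" "v \<in> A" for v
  proof -
    obtain g where "v = (\<Sum>i\<le>m. g i *s directrix_frame p i)"
      using coord_frame_coords[OF coord_frame_directrix \<open>v \<in> directrix_space p\<close>] .
    then show ?thesis
      using directrix_combination_in_A[of g p] \<open>v \<in> A\<close> by simp
  qed
  then show ?thesis
    using vec.subspace_0[OF subspace_A] vec.subspace_0[OF subspace_directrix_space] by blast
qed

lemma proj_space_directrix_space: "proj_space m (directrix_space p)"
  unfolding proj_space_def
  using subspace_directrix_space coord_frame_dim[OF coord_frame_directrix] by simp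

lemma proj_points_directrix_space_disjoint: "proj_points (directrix_space p) \<inter> proj_points A = {}"
  using directrix_space_Int_A proj_space_directrix_space subspace_A
  by (simp add: proj_points_disjoint_iff proj_space_def)

lemma normal_rational_curve_directrix: "normal_rational_curve m (directrix_space p) (directrix p)"
  unfolding normal_rational_curve_def directrix_def
  using proj_space_directrix_space coord_frame_directrix by blast

lemma directrix_subset_directrix_space: "directrix p \<subseteq> proj_points (directrix_space p)"
  unfolding directrix_def
  using nrc_point_in_proj_points_iff[OF coord_frame_directrix subspace_directrix_space]
    nrc_vector_mem[OF coord_frame_directrix] by blast

lemma directrix_vector_mem_generator_iff:
  assumes "degree p \<le> m - k"
  shows "nrc_vector m (directrix_frame p) s \<in> generator t \<longleftrightarrow> s = t"
proof
  assume "nrc_vector m (directrix_frame p) s \<in> generator t"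
  then obtain x y where "eval_form (m - k) p s *s low s + high s = x *s low t + y *s high t"
    unfolding mem_generator_iff nrc_vector_directrix_frame[OF assms] by blast
  then have "high s = y *s high t"
    using decomposition_unique[OF scale_low_mem scale_low_mem high_mem scale_high_mem] by blast
  then have "high s \<in> vec.span {high t}"
    by (simp add: vec.span_base vec.span_scale)
  then show "s = t"
    using nrc_params_eq_if_dim_le_1[OF frame_S, of "vec.span {high t}" s t] degree_less
    by (simp add: vec.span_base)
next
  assume "s = t"
  then show "nrc_vector m (directrix_frame p) s \<in> generator t"
    unfolding mem_generator_iff nrc_vector_directrix_frame[OF assms] by (metis vec.scale_one)
qed

lemma directrix_meets_generator_iff:
  assumes "degree p \<le> m - k"
  shows "P \<in> directrix p \<and> P \<in> proj_points (generator t) \<longleftrightarrow> P = nrc_point m (directrix_frame p) t"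
  unfolding directrix_def
  using nrc_point_in_proj_points_iff[OF coord_frame_directrix subspace_generator]
    directrix_vector_mem_generator_iff[OF assms] by auto

lemma directrix_subset_scroll:
  assumes "degree p \<le> m - k"
  shows "directrix p \<subseteq> scroll"
  using directrix_meets_generator_iff[OF assms] unfolding scroll_def directrix_def by blast

lemma eval_form_eq_if_directrix_eq:
  assumes degree: "degree p \<le> m - k" "degree p' \<le> m - k" and eq: "directrix p = directrix p'"
  shows "eval_form (m - k) p t = eval_form (m - k) p' t"
proof -
  let ?x = "eval_form (m - k) p t" and ?x' = "eval_form (m - k) p' t"
  let ?P = "nrc_point m (directrix_frame p) t"
  have "?P = nrc_point m (directrix_frame p') t"
    using directrix_meets_generator_iff[OF degree(1), of ?P t]
      directrix_meets_generator_iff[OF degree(2), of ?P t] eq by simp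
  then have "nrc_vector m (directrix_frame p) t \<in> vec.span {nrc_vector m (directrix_frame p') t}"
    unfolding nrc_point_def by (metis singletonI vec.span_base)
  then obtain y where "?x *s low t + high t = y *s (?x' *s low t + high t)"
    using degree by (auto simp: vec.span_singleton nrc_vector_directrix_frame)
  then have "?x *s low t + high t = (y * ?x') *s low t + y *s high t"
    by (simp add: vec.scale_right_distrib)
  then have "?x *s low t = (y * ?x') *s low t" "1 *s high t = y *s high t"
    using decomposition_unique[OF scale_low_mem scale_low_mem high_mem scale_high_mem] by simp_all
  moreover have "low t \<noteq> 0" "high t \<noteq> 0"
    using nrc_vector_nonzero frame_A frame_S by blast+
  ultimately have "?x = y * ?x'" "1 = y"
    by (simp_all only: vec.scale_cancel_right simp_thms)
  then show "?x = ?x'"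
    by simp
qed

lemma inj_on_directrix:
  assumes "m < CARD('a)"
  shows "inj_on directrix {p. degree p \<le> m - k}"
proof (rule inj_onI)
  fix p p'
  assume "p \<in> {p. degree p \<le> m - k}" "p' \<in> {p. degree p \<le> m - k}" "directrix p = directrix p'"
  then show "p = p'"
    using eval_form_eq_if_directrix_eq[of p p' "Some _"] assms
    by (intro poly_eqI_degree[of UNIV]) auto
qed

subsection \<open>Subspaces disjoint from \<open>A\<close>\<close>

lemma frame_S_lift:
  assumes "vec.subspace U" "m < CARD('a)" and mem: "\<And>t. l t *s low t + high t \<in> U" and "i \<le> m"
  obtains a where "f i + a \<in> U" "a \<in> A"
proof -
  let ?UA = "{u + a | u a. u \<in> U \<and> a \<in> A}"
  have "high t \<in> ?UA" for t
  proof -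
    have "high t = (l t *s low t + high t) + (- l t) *s low t"
      by simp
    then show ?thesis
      using mem scale_low_mem by blast
  qed
  then have "S \<subseteq> ?UA"
    using assms(1,2) by (intro nrc_subspace_subset[OF frame_S] vec.subspace_sums subspace_A) simp_all
  then obtain u a where "f i = u + a" "u \<in> U" "a \<in> A"
    using coord_frame_mem[OF frame_S \<open>i \<le> m\<close>] by blast
  then show ?thesis
    using that[of "- a"] vec.subspace_neg[OF subspace_A] by simp
qed

lemma frame_S_lift_coords:
  assumes "vec.subspace U" "m < CARD('a)" "\<And>t. l t *s low t + high t \<in> U"
  obtains P where "\<And>j. degree (P j) \<le> m" "\<And>i. i \<le> m \<Longrightarrow> f i + (\<Sum>j\<le>k. coeff (P j) i *s e j) \<in> U"
proof -
  have "\<exists>x. f i + (\<Sum>j\<le>k. x j *s e j) \<in> U" if "i \<le> m" for i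
    using frame_S_lift[OF assms that] coord_frame_coords[OF frame_A] by metis
  then obtain x where lift: "\<And>i. i \<le> m \<Longrightarrow> f i + (\<Sum>j\<le>k. x i j *s e j) \<in> U"
    by metis
  define P where "P j = (\<Sum>i\<le>m. monom (x i j) i)" for j
  have "coeff (P j) i = x i j" if "i \<le> m" for i j
    unfolding P_def using that by (simp add: coeff_sum)
  moreover have "degree (P j) \<le> m" for j
    unfolding P_def by (intro degree_sum_le) (auto intro: order_trans[OF degree_monom_le])
  ultimately show ?thesis
    using that[of P] lift by simp
qed

lemma form_if_on_disjoint_subspace:
  assumes U: "vec.subspace U" "U \<inter> A = {0}" and "m < CARD('a)"
    and mem: "\<And>t. l t *s low t + high t \<in> U"
  obtains p where "degree p \<le> m - k" "l = eval_form (m - k) p"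
proof -
  obtain P where degree: "\<And>j. degree (P j) \<le> m"
    and lift: "\<And>i. i \<le> m \<Longrightarrow> f i + (\<Sum>j\<le>k. coeff (P j) i *s e j) \<in> U"
    using frame_S_lift_coords[OF U(1) assms(3) mem] by blast
  define a where "a t = (\<Sum>j\<le>k. eval_form m (P j) t *s e j)" for t
  have a_eq: "a t = l t *s low t" for t
  proof -
    have "nrc_vector m (\<lambda>i. f i + (\<Sum>j\<le>k. coeff (P j) i *s e j)) t = high t + a t"
      unfolding nrc_vector_add a_def by (simp add: nrc_vector_coeff_sum degree)
    moreover have "nrc_vector m (\<lambda>i. f i + (\<Sum>j\<le>k. coeff (P j) i *s e j)) t \<in> U"
      unfolding nrc_vector_eq_sum using lift by (intro vec.subspace_sum vec.subspace_scale U(1)) simp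
    ultimately have "high t + a t \<in> U"
      by simp
    from vec.subspace_diff[OF U(1) this mem[of t]] have "a t - l t *s low t \<in> U"
      by simp
    moreover have "a t - l t *s low t \<in> A"
      unfolding a_def
      by (intro vec.subspace_diff subspace_A coord_frame_sum_mem[OF frame_A] scale_low_mem)
    ultimately have "a t - l t *s low t \<in> U \<inter> A" ..
    then show ?thesis
      unfolding U(2) by simp
  qed
  have coords: "eval_form m (P j) t = l t * eval_form k (monom 1 j) t" if "j \<le> k" for j t
  proof -
    have "(\<Sum>j\<le>k. eval_form m (P j) t *s e j) = (\<Sum>j\<le>k. (l t * eval_form k (monom 1 j) t) *s e j)"
      using a_eq[of t] by (simp add: a_def nrc_vector_eq_sum[of k] vec.scale_sum_right vec.scale_scale)
    then show ?thesis
      using that by (rule coord_frame_coords_eq[OF frame_A])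
  qed
  show ?thesis
    by (rule form_quotient_exists[OF less_imp_le[OF degree_less] assms(3) degree coords])
      (auto intro: that)
qed

subsection \<open>Projection from \<open>A\<close>\<close>

definition cone :: "'a option \<Rightarrow> ('a ^ 'n) set" where
  "cone t = vec.span (insert (high t) A)"

definition projection :: "('a ^ 'n) set \<Rightarrow> ('a ^ 'n) set" where
  "projection U = {u + a | u a. u \<in> U \<and> a \<in> A} \<inter> S"

lemma A_subset_cone: "A \<subseteq> cone t"
  unfolding cone_def by (simp add: vec.span_base subsetI)

lemma generator_subset_cone: "generator t \<subseteq> cone t"
  unfolding cone_def generator_def using low_mem by (intro vec.span_mono) simp

lemma dim_Int_cone_le:
  assumes "vec.subspace U"
  shows "vec.dim (U \<inter> cone t) \<le> vec.dim (U \<inter> A) + 1"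
proof -
  have "vec.dim (cone t) \<le> vec.dim A + 1"
    unfolding cone_def by (simp add: vec.dim_insert)
  moreover have "vec.subspace (cone t)"
    unfolding cone_def by simp
  ultimately show ?thesis
    using vec.dim_Int_superspace_le[OF assms subspace_A _ A_subset_cone, of t] by simp
qed

lemma high_mem_projection:
  assumes "vec.subspace U" "v \<in> U" "v \<in> generator t" "v \<notin> A"
  shows "high t \<in> projection U"
proof -
  obtain x y where v: "v = x *s low t + y *s high t"
    using assms(3) mem_generator_iff by blast
  with assms(4) scale_low_mem have "y \<noteq> 0"
    by auto
  then have "high t = (1 / y) *s v + (- x / y) *s low t"
    unfolding v by (simp add: vec_eq_iff field_simps)
  then show ?thesis
    unfolding projection_def using vec.subspace_scale[OF assms(1,2)] scale_low_mem high_mem by blast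
qed

lemma card_high_params_projection_le:
  assumes "vec.subspace U" "vec.dim U = m + 1" "vec.dim (U \<inter> A) > 0"
  shows "card (nrc_params m f (projection U)) + vec.dim (U \<inter> A) \<le> m + 1"
proof -
  have "vec.dim (projection U) + vec.dim (U \<inter> A) \<le> m + 1"
    unfolding projection_def
    using vec.dim_projection_le[OF assms(1) subspace_A subspace_S A_Int_S] assms(2) by simp
  then show ?thesis
    using card_nrc_params_le_dim[OF frame_S, of "projection U"] assms(3) by linarith
qed

end

subsection \<open>Curves contained in the scroll\<close>

locale curve_on_rational_normal_scroll = rational_normal_scroll k m A S e f
  for k m :: nat and A S :: "('a::{field,finite} ^ 'n) set" and e f :: "nat \<Rightarrow> 'a ^ 'n" +
  fixes U :: "('a ^ 'n) set" and g :: "nat \<Rightarrow> 'a ^ 'n"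
  assumes frame_U: "coord_frame m U g" and on_generator: "\<exists>s. nrc_vector m g t \<in> generator s"
begin

abbreviation "curve \<equiv> nrc_vector m g"

lemmas subspace_U = coord_frame_subspace[OF frame_U] and dim_U = coord_frame_dim[OF frame_U]
lemmas curve_mem = nrc_vector_mem[OF frame_U]

lemma projected_generatorE:
  assumes "curve t \<notin> A"
  obtains s where "s \<in> nrc_params m f (projection U)" "curve t \<in> generator s"
proof -
  obtain s where s: "curve t \<in> generator s"
    using on_generator by blast
  then have "s \<in> nrc_params m f (projection U)"
    using high_mem_projection[OF subspace_U curve_mem _ assms] unfolding nrc_params_def by blast
  with s that show ?thesis
    by blast
qed

lemma dim_U_Int_A_neq_1:
  assumes "2 \<le> m" "2 * m \<le> CARD('a)"
  shows "vec.dim (U \<inter> A) \<noteq> 1"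
proof
  assume dim_1: "vec.dim (U \<inter> A) = 1"
  let ?I = "nrc_params m f (projection U)"
  have "\<exists>t. curve t \<notin> A"
  proof (rule ccontr)
    assume "\<not> ?thesis"
    then have "U \<subseteq> A"
      using assms(2) by (intro nrc_subspace_subset[OF frame_U _ subspace_A]) simp_all
    then have "vec.dim U \<le> vec.dim A"
      by (rule vec.dim_subset)
    then show False
      using dim_U dim_A degree_less by simp
  qed
  then obtain r where "r \<in> ?I"
    using projected_generatorE by blast
  have "t \<in> (\<Union>s\<in>?I. nrc_params m g (U \<inter> cone s))" for t
  proof (cases "curve t \<in> A")
    case True
    then show ?thesis
      using \<open>r \<in> ?I\<close> curve_mem A_subset_cone unfolding nrc_params_def by blast
  next
    case False
    then obtain s where "s \<in> ?I" "curve t \<in> generator s"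
      by (rule projected_generatorE)
    then show ?thesis
      using curve_mem generator_subset_cone unfolding nrc_params_def by blast
  qed
  then have "(\<Union>s\<in>?I. nrc_params m g (U \<inter> cone s)) = UNIV"
    by blast
  moreover have "vec.dim (U \<inter> cone s) \<le> 2" for s
    using dim_Int_cone_le[OF subspace_U, of s] dim_1 by simp
  then have "card (\<Union>s\<in>?I. nrc_params m g (U \<inter> cone s)) \<le> card ?I * 2"
    using assms(1) by (intro card_UN_nrc_params_le[OF frame_U]) simp_all
  ultimately show False
    using card_high_params_projection_le[OF subspace_U] dim_U dim_1 assms(2) by simp
qed

lemma dim_U_Int_A_less_2:
  assumes "2 \<le> m" "2 * m \<le> CARD('a)"
  shows "vec.dim (U \<inter> A) < 2"
proof (rule ccontr)
  assume dim_2: "\<not> vec.dim (U \<inter> A) < 2"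
  let ?I = "nrc_params m f (projection U)"
  have "t \<in> nrc_params m g (U \<inter> A) \<union> (\<Union>s\<in>?I. nrc_params m g (generator s))" for t
    using projected_generatorE[of t] curve_mem[of t] unfolding nrc_params_def by blast
  then have "nrc_params m g (U \<inter> A) \<union> (\<Union>s\<in>?I. nrc_params m g (generator s)) = UNIV"
    by blast
  then have "CARD('a option) \<le>
      card (nrc_params m g (U \<inter> A)) + card (\<Union>s\<in>?I. nrc_params m g (generator s))"
    by (metis card_Un_le)
  moreover have "vec.dim (U \<inter> A) \<le> m"
    using vec.dim_subset[of "U \<inter> A" A] dim_A degree_less by simp
  then have "card (nrc_params m g (U \<inter> A)) \<le> vec.dim (U \<inter> A)"
    by (rule card_nrc_params_le_dim[OF frame_U])
  moreover have "card (\<Union>s\<in>?I. nrc_params m g (generator s)) \<le> card ?I * 2"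
    using assms(1) dim_generator_le by (intro card_UN_nrc_params_le[OF frame_U]) simp_all
  moreover have "card ?I + vec.dim (U \<inter> A) \<le> m + 1"
    using card_high_params_projection_le[OF subspace_U] dim_U dim_2 by simp
  ultimately show False
    using dim_2 assms(2) by simp
qed

lemma U_Int_A_eq_zero:
  assumes "2 \<le> m" "2 * m \<le> CARD('a)"
  shows "U \<inter> A = {0}"
proof -
  have "vec.dim (U \<inter> A) = 0"
    using dim_U_Int_A_neq_1[OF assms] dim_U_Int_A_less_2[OF assms] by linarith
  then show ?thesis
    using vec.subspace_0[OF subspace_U] vec.subspace_0[OF subspace_A] by auto
qed

lemma param_eq_if_on_same_generator:
  assumes disjoint: "U \<inter> A = {0}" and "curve s \<in> generator r" "curve t \<in> generator r"
  shows "s = t"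
proof -
  have low_span: "vec.span {low r} \<subseteq> A" "vec.span {low r} \<subseteq> generator r"
    using low_mem unfolding generator_def
    by (simp_all add: vec.span_minimal subspace_A vec.span_mono)
  have "U \<inter> vec.span {low r} \<subseteq> {0}"
    using low_span(1) disjoint by blast
  then have "vec.dim (U \<inter> vec.span {low r}) = 0"
    by simp
  moreover have "vec.dim (vec.span {low r}) = 1"
    using nrc_vector_nonzero[OF frame_A, of r] by simp
  ultimately have "vec.dim (U \<inter> generator r) \<le> 1"
    using vec.dim_Int_superspace_le[OF subspace_U vec.subspace_span subspace_generator low_span(2)]
      dim_generator_le[of r] by linarith
  then show ?thesis
    using nrc_params_eq_if_dim_le_1[OF frame_U] degree_less assms(2,3) curve_mem by simp
qed

lemma curve_points_if_disjoint:
  assumes disjoint: "U \<inter> A = {0}"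
  obtains \<sigma> l where "surj \<sigma>" "\<And>t. nrc_point m g t = vec.span {l (\<sigma> t) *s low (\<sigma> t) + high (\<sigma> t)}"
proof -
  have "\<exists>s x y. curve t = x *s low s + y *s high s" for t
    using on_generator mem_generator_iff by blast
  then obtain \<sigma> x y where curve: "\<And>t. curve t = x t *s low (\<sigma> t) + y t *s high (\<sigma> t)"
    by metis
  have "inj \<sigma>"
  proof (rule injI)
    fix s t
    assume "\<sigma> s = \<sigma> t"
    then have "curve s \<in> generator (\<sigma> t)" "curve t \<in> generator (\<sigma> t)"
      using curve mem_generator_iff by metis+
    then show "s = t"
      by (rule param_eq_if_on_same_generator[OF disjoint])
  qed
  define l where "l s = x (inv \<sigma> s) / y (inv \<sigma> s)" for s
  have "nrc_point m g t = vec.span {l (\<sigma> t) *s low (\<sigma> t) + high (\<sigma> t)}" for t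
  proof -
    have "y t \<noteq> 0"
    proof
      assume "y t = 0"
      then have "curve t \<in> U \<inter> A"
        using curve[of t] curve_mem[of t] scale_low_mem by simp
      then show False
        unfolding disjoint using nrc_vector_nonzero[OF frame_U] by simp
    qed
    then have "curve t = y t *s (l (\<sigma> t) *s low (\<sigma> t) + high (\<sigma> t))"
      unfolding curve l_def using \<open>inj \<sigma>\<close> by (simp add: vec.scale_right_distrib)
    then show ?thesis
      by (simp only: nrc_point_def span_singleton_scale[OF \<open>y t \<noteq> 0\<close>])
  qed
  moreover have "surj \<sigma>"
    using \<open>inj \<sigma>\<close> by (simp add: finite_UNIV_inj_surj)
  ultimately show ?thesis
    using that by blast
qed

lemma directrix_if_disjoint:
  assumes disjoint: "U \<inter> A = {0}" and "m < CARD('a)"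
  obtains p where "degree p \<le> m - k" "range (nrc_point m g) = directrix p"
proof -
  obtain \<sigma> l where "surj \<sigma>"
    and points: "\<And>t. nrc_point m g t = vec.span {l (\<sigma> t) *s low (\<sigma> t) + high (\<sigma> t)}"
    using curve_points_if_disjoint[OF disjoint] by blast
  have "l s *s low s + high s \<in> U" for s
  proof -
    obtain t where "s = \<sigma> t"
      using \<open>surj \<sigma>\<close> by (rule surjE)
    then have "l s *s low s + high s \<in> nrc_point m g t"
      unfolding points by (simp add: vec.span_base)
    moreover have "nrc_point m g t \<subseteq> U"
      unfolding nrc_point_def using curve_mem by (simp add: vec.span_minimal subspace_U)
    ultimately show ?thesis ..
  qed
  then obtain p where p: "degree p \<le> m - k" "l = eval_form (m - k) p"
    using form_if_on_disjoint_subspace[OF subspace_U disjoint assms(2)] by blast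
  then have "nrc_point m g t = nrc_point m (directrix_frame p) (\<sigma> t)" for t
    unfolding points nrc_point_def[of m "directrix_frame p"] by (simp add: nrc_vector_directrix_frame)
  then have "range (nrc_point m g) = nrc_point m (directrix_frame p) ` range \<sigma>"
    by (simp add: image_image)
  with \<open>surj \<sigma>\<close> that p(1) show ?thesis
    unfolding directrix_def by simp
qed

end

context rational_normal_scroll
begin

lemma directrix_if_subset_scroll:
  assumes degree: "2 \<le> m" "2 * m \<le> CARD('a)"
    and N: "normal_rational_curve m U N" "N \<subseteq> scroll"
  obtains p where "degree p \<le> m - k" "N = directrix p"
proof -
  obtain g where g: "coord_frame m U g" and N_eq: "N = range (nrc_point m g)"
    using N(1) unfolding normal_rational_curve_def by blast
  have "\<exists>s. nrc_vector m g t \<in> generator s" for t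
    using N(2) nrc_point_in_proj_points_iff[OF g subspace_generator]
    unfolding N_eq scroll_def by blast
  with g interpret curve_on_rational_normal_scroll k m A S e f U g
    by unfold_locales
  have "m < CARD('a)"
    using degree by linarith
  then show ?thesis
    using directrix_if_disjoint[OF U_Int_A_eq_zero[OF degree]] that unfolding N_eq by blast
qed

theorem normal_rational_curves_on_scroll:
  assumes "2 \<le> m" "2 * m \<le> CARD('a)"
  shows "{N. (\<exists>U. normal_rational_curve m U N) \<and> N \<subseteq> scroll} = directrix ` {p. degree p \<le> m - k}"
proof (intro equalityI subsetI)
  fix N
  assume "N \<in> {N. (\<exists>U. normal_rational_curve m U N) \<and> N \<subseteq> scroll}"
  then obtain U where "normal_rational_curve m U N" "N \<subseteq> scroll"
    by blast
  then obtain p where "degree p \<le> m - k" "N = directrix p"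
    using directrix_if_subset_scroll[OF assms] by blast
  then show "N \<in> directrix ` {p. degree p \<le> m - k}"
    by blast
qed (use normal_rational_curve_directrix directrix_subset_scroll in blast)

theorem card_normal_rational_curves_on_scroll:
  assumes "2 \<le> m" "2 * m \<le> CARD('a)"
  shows "card {N. (\<exists>U. normal_rational_curve m U N) \<and> N \<subseteq> scroll} = CARD('a) ^ (m - k + 1)"
  unfolding normal_rational_curves_on_scroll[OF assms]
  using assms card_image[OF inj_on_directrix] by (simp add: card_polys_degree_le)

end

lemma ruled_quintic_surfaceE:
  fixes \<alpha> :: "('a::{field,finite} ^ 7) set"
  assumes "ruled_quintic_surface \<alpha> G V" "3 \<le> CARD('a)"
  obtains S e f where "rational_normal_scroll 2 3 \<alpha> S e f"
    and "G = range (rational_normal_scroll.generator 2 3 e f)"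
    and "V = rational_normal_scroll.scroll 2 3 e f"
proof -
  obtain S e f' \<phi> where \<alpha>: "proj_space 2 \<alpha>" and S: "proj_space 3 S"
    and "proj_points \<alpha> \<inter> proj_points S = {}"
    and e: "coord_frame 2 \<alpha> e" and f': "coord_frame 3 S f'" and \<phi>: "\<phi> \<in> PGL2"
    and G: "G = generators e f' \<phi>" and V: "V = (\<Union>l\<in>G. proj_points l)"
    using assms(1) unfolding ruled_quintic_surface_def by blast
  then have "\<alpha> \<inter> S = {0}"
    using proj_points_disjoint_iff unfolding proj_space_def by blast
  obtain f where f: "coord_frame 3 S f" and points: "\<And>t. nrc_point 3 f t = nrc_point 3 f' (\<phi> t)"
    using nrc_reparametrisation[OF f' assms(2) \<phi>] by blast
  interpret rational_normal_scroll 2 3 \<alpha> S e f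
    using e f \<open>\<alpha> \<inter> S = {0}\<close> by unfold_locales simp_all
  have G_eq: "G = range generator"
    unfolding G generators_def points[symmetric] span_points_eq_generator ..
  moreover have "V = scroll"
    unfolding V scroll_def G_eq by blast
  ultimately show ?thesis
    using that rational_normal_scroll_axioms by blast
qed

theorem theorem3p2:
  fixes \<alpha> :: "('a::{field,finite} ^ 7) set" and G V :: "('a ^ 7) set set"
  assumes "CARD('a) \<ge> 6"
    and "ruled_quintic_surface \<alpha> G V"
  shows "card {N. twisted_cubic N \<and> N \<subseteq> V} = CARD('a)\<^sup>2 \<and>
    (\<forall>N. twisted_cubic N \<and> N \<subseteq> V \<longrightarrow>
       (\<exists>S. proj_space 3 S \<and> proj_points S \<inter> proj_points \<alpha> = {} \<and> N \<subseteq> proj_points S) \<and>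
       (\<forall>l\<in>G. \<exists>!P. P \<in> N \<and> P \<in> proj_points l))"
proof (intro conjI allI impI)
  have large: "3 \<le> CARD('a)" "2 \<le> (3 :: nat)" "2 * 3 \<le> CARD('a)"
    using assms(1) by simp_all
  obtain S e f where scroll: "rational_normal_scroll 2 3 \<alpha> S e f"
    and G: "G = range (rational_normal_scroll.generator 2 3 e f)"
    and V: "V = rational_normal_scroll.scroll 2 3 e f"
    using ruled_quintic_surfaceE[OF assms(2) large(1)] by blast
  interpret rational_normal_scroll 2 3 \<alpha> S e f
    by (rule scroll)
  show "card {N. twisted_cubic N \<and> N \<subseteq> V} = CARD('a)\<^sup>2"
    using card_normal_rational_curves_on_scroll[OF large(2,3)] unfolding twisted_cubic_def V
    by (simp add: power2_eq_square)
  fix N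
  assume "twisted_cubic N \<and> N \<subseteq> V"
  then obtain p where degree: "degree p \<le> 3 - 2" and N: "N = directrix p"
    unfolding twisted_cubic_def V using directrix_if_subset_scroll[OF large(2,3)] by blast
  show "\<exists>S. proj_space 3 S \<and> proj_points S \<inter> proj_points \<alpha> = {} \<and> N \<subseteq> proj_points S"
    unfolding N using proj_space_directrix_space proj_points_directrix_space_disjoint
      directrix_subset_directrix_space by blast
  show "\<forall>l\<in>G. \<exists>!P. P \<in> N \<and> P \<in> proj_points l"
    unfolding G N using directrix_meets_generator_iff[OF degree] by simp
qed

end
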